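(* The element $1$ is the only (nonzero) torsion element of the Abelian group $\mathcal{D}$.
   Context: A (misère impartial) game is a hereditarily finite set; its elements are called its options. $0=\{\}$, $1=\{0\}$. The sum is $G+H=\{G'+H: G'\in G\}\cup\{G+H':H'\in H\}$. Misère outcome: $G$ is a $\mathscr{P}$-position if $G$ is nonempty and every option of $G$ is an $\mathscr{N}$-position; otherwise $G$ is an $\mathscr{N}$-position. $G=H$ means that $G+X$ and $H+X$ have the same misère outcome for every game $X$. $\mathcal{M}$ is the commutative monoid of games modulo equality; it is cancellative ($G+T=H+T$ implies $G=H$). $\mathcal{D}$ is its group of differences: $\mathcal{D}=\{G-H:G,H\in\mathcal{M}\}$ with $G_1-H_1=G_2-H_2$ iff $G_1+H_2=G_2+H_1$; $\mathcal{M}$ is regarded as embedded in $\mathcal{D}$. *)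

theory Defs
  imports Main "HOL-Library.FSet"
begin

section \<open>Games\<close>

text \<open>The datatype is freely generated by a constructor that takes a finite set of games, so its
  elements are exactly the hereditarily finite sets, and set equality is HOL equality.\<close>

datatype game = Game (opts: "game fset")

lemma game_eqI: "opts G = opts H \<Longrightarrow> G = H"
  by (cases G; cases H) simp

lemma size_opts [termination_simp]: "G' |\<in>| opts G \<Longrightarrow> size G' < size G"
proof (cases G)
  case (Game A)
  assume "G' |\<in>| opts G"
  then have "G' \<in> fset A" using Game by simp
  then have "Suc (size G') \<le> (\<Sum>x\<in>fset A. Suc (size x))"
    by (intro member_le_sum) auto
  then show ?thesis using Game by (simp add: size_fset_overloaded_simps)
qed

instantiation game :: "{zero, one, plus}"
begin

definition zero_game :: game where "0 = Game {||}"
definition one_game :: game where "1 = Game {|0|}"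

function plus_game :: "game \<Rightarrow> game \<Rightarrow> game" where
  "plus_game G H = Game (((\<lambda>G'. plus_game G' H) |`| opts G) |\<union>| ((\<lambda>H'. plus_game G H') |`| opts H))"
  by auto
termination
  by (relation "measure (\<lambda>(G, H). size G + size H)") (auto simp: size_opts)

instance ..

end

declare plus_game.simps [simp del]

lemma opts_zero [simp]: "opts 0 = {||}" by (simp add: zero_game_def)
lemma opts_one [simp]: "opts 1 = {|0|}" by (simp add: one_game_def)

lemma opts_plus:
  "opts (G + H) = ((\<lambda>G'. G' + H) |`| opts G) |\<union>| ((\<lambda>H'. G + H') |`| opts H)"
  for G H :: game
  by (subst plus_game.simps) simp

lemma mem_opts_plus:
  "X |\<in>| opts (G + H) \<longleftrightarrow> (\<exists>G'. G' |\<in>| opts G \<and> X = G' + H) \<or> (\<exists>H'. H' |\<in>| opts H \<and> X = G + H')"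
  by (auto simp: opts_plus)

lemma opts_empty_iff: "opts G = {||} \<longleftrightarrow> G = 0"
  by (metis game_eqI opts_zero)

lemma opts_plus_empty: "opts (G + H) = {||} \<longleftrightarrow> G = 0 \<and> H = 0"
  by (simp add: opts_plus opts_empty_iff)

lemma game_add_commute: "G + H = H + G" for G H :: game
proof (induction "size G + size H" arbitrary: G H rule: less_induct)
  case less
  have "G' + H = H + G'" if "G' |\<in>| opts G" for G' using less size_opts[OF that] by simp
  moreover have "G + H' = H' + G" if "H' |\<in>| opts H" for H' using less size_opts[OF that] by simp
  ultimately have "opts (G + H) = opts (H + G)"
    unfolding opts_plus[of G] opts_plus[of H]
    by (subst funion_commute) (intro arg_cong2[where f = "(|\<union>|)"] fimage_cong; simp)
  then show ?case by (rule game_eqI)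
qed

lemma game_add_assoc: "G + H + K = G + (H + K)" for G H K :: game
proof (induction "size G + size H + size K" arbitrary: G H K rule: less_induct)
  case less
  have 1: "G' + H + K = G' + (H + K)" if "G' |\<in>| opts G" for G' using less size_opts[OF that] by simp
  have 2: "G + H' + K = G + (H' + K)" if "H' |\<in>| opts H" for H' using less size_opts[OF that] by simp
  have 3: "G + H + K' = G + (H + K')" if "K' |\<in>| opts K" for K' using less size_opts[OF that] by simp
  have "opts (G + H + K) = opts (G + (H + K))"
  proof (rule fset_eqI)
    fix X
    have "X |\<in>| opts (G + H + K) \<longleftrightarrow> (\<exists>G'. G' |\<in>| opts G \<and> X = G' + H + K) \<or>
      (\<exists>H'. H' |\<in>| opts H \<and> X = G + H' + K) \<or> (\<exists>K'. K' |\<in>| opts K \<and> X = G + H + K')"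
      unfolding mem_opts_plus[of X "G + H"] mem_opts_plus[of _ G H] by blast
    also have "\<dots> \<longleftrightarrow> (\<exists>G'. G' |\<in>| opts G \<and> X = G' + (H + K)) \<or>
      (\<exists>H'. H' |\<in>| opts H \<and> X = G + (H' + K)) \<or> (\<exists>K'. K' |\<in>| opts K \<and> X = G + (H + K'))"
      using 1 2 3 by (auto cong: conj_cong)
    also have "\<dots> \<longleftrightarrow> X |\<in>| opts (G + (H + K))"
      unfolding mem_opts_plus[of X G] mem_opts_plus[of _ H K] by blast
    finally show "X |\<in>| opts (G + H + K) \<longleftrightarrow> X |\<in>| opts (G + (H + K))" .
  qed
  then show ?case by (rule game_eqI)
qed

lemma game_add_0: "0 + G = G" for G :: game
proof (induction "size G" arbitrary: G rule: less_induct)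
  case less
  have "0 + G' = G'" if "G' |\<in>| opts G" for G' using less size_opts[OF that] by simp
  then have "opts (0 + G) = opts G"
    unfolding opts_plus[of 0] by (simp cong: fimage_cong)
  then show ?case by (rule game_eqI)
qed

instance game :: comm_monoid_add
  by standard (rule game_add_assoc game_add_commute game_add_0)+

section \<open>Outcomes and equality\<close>

text \<open>Misere play: an N-position is a game that is not a P-position; in particular the empty game
  is an N-position.\<close>

function P_position :: "game \<Rightarrow> bool" where
  "P_position G \<longleftrightarrow> opts G \<noteq> {||} \<and> (\<forall>G' |\<in>| opts G. \<not> P_position G')"
  by auto
termination by (relation "measure size") (auto simp: size_opts)

declare P_position.simps [simp del]

definition misere_eq :: "game \<Rightarrow> game \<Rightarrow> bool" where
  "misere_eq G H \<longleftrightarrow> (\<forall>X. P_position (G + X) \<longleftrightarrow> P_position (H + X))"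

quotient_type mgame = game / misere_eq
  by (rule equivpI) (auto simp: reflp_def symp_def transp_def misere_eq_def)

instantiation mgame :: "{comm_monoid_add, one}"
begin

lift_definition zero_mgame :: mgame is 0 .
lift_definition one_mgame :: mgame is 1 .
lift_definition plus_mgame :: "mgame \<Rightarrow> mgame \<Rightarrow> mgame" is "(+)"
  by (simp add: misere_eq_def) (metis add.assoc add.commute)

instance
  by standard (transfer; simp add: misere_eq_def ac_simps)+

end

section \<open>Cancellation\<close>

text \<open>The relation defining the group of differences is transitive only because the monoid
  of misere games is cancellative, so this has to be established first.\<close>

text \<open>The proof is by induction on \<open>T\<close>, the game to be cancelled. Two games are linked if a common
  summand makes both P-positions. Linkedness is controlled by equality between one game and the
  options of the other (\<open>linkedI\<close>, \<open>option_not_linked\<close>), and equality by linkedness (\<open>mgame_eqI\<close>),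
  up to an exceptional case for the empty game, which \<open>no_absorb\<close> handles.\<close>

lemma mgame_add: "abs_mgame (G + H) = abs_mgame G + abs_mgame H"
  by (simp add: plus_mgame.abs_eq)

lemma mgame_eq_iff:
  "abs_mgame G = abs_mgame H \<longleftrightarrow> (\<forall>X. P_position (G + X) \<longleftrightarrow> P_position (H + X))"
  by (simp add: mgame.abs_eq_iff misere_eq_def)

lemma mgame_outcome: "abs_mgame G = abs_mgame H \<Longrightarrow> P_position G \<longleftrightarrow> P_position H"
  unfolding mgame_eq_iff by (metis add.right_neutral)

lemma P_option: "P_position G \<Longrightarrow> G' |\<in>| opts G \<Longrightarrow> \<not> P_position G'"
  using P_position.simps[of G] by blast

lemma N_I: "G' |\<in>| opts G \<Longrightarrow> P_position G' \<Longrightarrow> \<not> P_position G"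
  using P_option by blast

lemma P_I: "G \<noteq> 0 \<Longrightarrow> (\<And>G'. G' |\<in>| opts G \<Longrightarrow> \<not> P_position G') \<Longrightarrow> P_position G"
  using P_position.simps[of G] by (auto simp: opts_empty_iff)

lemma N_E:
  assumes "\<not> P_position G" "G \<noteq> 0"
  obtains G' where "G' |\<in>| opts G" "P_position G'"
  using assms P_I by blast

lemma not_P_0 [simp]: "\<not> P_position 0" by (subst P_position.simps) simp
lemma one_neq_0 [simp]: "(1 :: game) \<noteq> 0" by (metis opts_one opts_zero finsert_not_fempty)
lemma P_1 [simp]: "P_position 1" by (rule P_I) simp_all

lemma plus_eq_0: "G + H = 0 \<longleftrightarrow> G = 0 \<and> H = 0" for G H :: game
  using opts_plus_empty opts_empty_iff by metis

lemma opt1: "G' |\<in>| opts G \<Longrightarrow> G' + H |\<in>| opts (G + H)"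
  and opt2: "H' |\<in>| opts H \<Longrightarrow> G + H' |\<in>| opts (G + H)"
  by (auto simp: mem_opts_plus)

lemma mate_exists: "\<exists>Y. P_position (X + Y)"
proof -
  have "\<exists>m. \<forall>X. P_position (X + m X)"
  proof -
    define m where "m = rec_game (\<lambda>A. if A = {||} then 1 else Game (snd |`| A))"
    have m: "m (Game A) = (if A = {||} then 1 else Game (m |`| A))" for A
      by (simp add: m_def fset.map_comp comp_def)
    have "P_position (X + m X)" for X
    proof (induction X)
      case (Game A)
      show ?case
      proof (cases "A = {||}")
        case True
        then show ?thesis using m[of A] by (simp add: zero_game_def[symmetric])
      next
        case False
        then have ne: "Game A \<noteq> 0" by (simp add: zero_game_def)
        have mA: "opts (m (Game A)) = m |`| A" using False by (simp add: m)
        show ?thesis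
        proof (rule P_I)
          show "Game A + m (Game A) \<noteq> 0" using ne by (simp add: plus_eq_0)
          fix Y assume "Y |\<in>| opts (Game A + m (Game A))"
          then consider a where "a |\<in>| A" "Y = a + m (Game A)" | a where "a |\<in>| A" "Y = Game A + m a"
            unfolding mem_opts_plus mA by auto
          then show "\<not> P_position Y"
          proof cases
            case 1
            then have "a + m a |\<in>| opts Y" using mA by (simp add: opt2)
            then show ?thesis using Game.IH[of a] 1(1) N_I[of "a + m a" Y] by simp
          next
            case 2
            then have "a + m a |\<in>| opts Y" by (simp add: opt1)
            then show ?thesis using Game.IH[of a] 2(1) N_I[of "a + m a" Y] by simp
          qed
        qed
      qed
    qed
    then show ?thesis by blast
  qed
  then show ?thesis by blast
qed

lemma distinguish:
  assumes "abs_mgame G \<noteq> abs_mgame H"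
  obtains T where "P_position (H + T)" "\<not> P_position (G + T)"
proof -
  obtain X where X: "P_position (G + X) \<noteq> P_position (H + X)" using assms mgame_eq_iff by blast
  show thesis
  proof (cases "P_position (H + X)")
    case True
    with X that show ?thesis by blast
  next
    case False
    with X have G: "P_position (G + X)" by blast
    obtain m where m: "\<And>Y. P_position (Y + m Y)" using mate_exists by metis
    define T where "T = Game (finsert X (m |`| opts H))"
    have oT: "opts T = finsert X (m |`| opts H)" by (simp add: T_def)
    then have T0: "T \<noteq> 0" using opts_empty_iff[of T] by auto
    have "P_position (H + T)"
    proof (rule P_I)
      show "H + T \<noteq> 0" using T0 by (simp add: plus_eq_0)
      fix Y assume "Y |\<in>| opts (H + T)"
      then consider H' where "H' |\<in>| opts H" "Y = H' + T" | "Y = H + X"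
        | H' where "H' |\<in>| opts H" "Y = H + m H'"
        unfolding mem_opts_plus oT by auto
      then show "\<not> P_position Y"
      proof cases
        case 1
        then have "H' + m H' |\<in>| opts Y" by (auto intro!: opt2 simp: oT)
        then show ?thesis using m N_I by blast
      next
        case 2
        then show ?thesis using False by simp
      next
        case 3
        then have "H' + m H' |\<in>| opts Y" by (auto intro!: opt1)
        then show ?thesis using m N_I by blast
      qed
    qed
    moreover have "\<not> P_position (G + T)"
      by (rule N_I[OF opt2 G]) (simp add: oT)
    ultimately show ?thesis by (rule that)
  qed
qed

definition linked :: "game \<Rightarrow> game \<Rightarrow> bool" where
  "linked G H \<longleftrightarrow> (\<exists>T. P_position (G + T) \<and> P_position (H + T))"

lemma linked_sym: "linked G H \<Longrightarrow> linked H G" by (auto simp: linked_def)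

lemma linked_eq: "linked G H \<Longrightarrow> abs_mgame H = abs_mgame K \<Longrightarrow> linked G K"
  unfolding linked_def mgame_eq_iff by blast

lemma linkedI:
  assumes H: "\<And>H'. H' |\<in>| opts H \<Longrightarrow> abs_mgame G \<noteq> abs_mgame H'"
    and G: "\<And>G'. G' |\<in>| opts G \<Longrightarrow> abs_mgame G' \<noteq> abs_mgame H"
  shows "linked G H"
proof (cases "G = 0 \<and> H = 0")
  case True
  then show ?thesis unfolding linked_def by (intro exI[of _ 1]) simp
next
  case False
  have "\<exists>S. P_position (H' + S) \<and> \<not> P_position (G + S)" if "H' |\<in>| opts H" for H'
    using distinguish[OF H[OF that]] by blast
  then obtain s where s: "\<And>H'. H' |\<in>| opts H \<Longrightarrow> P_position (H' + s H') \<and> \<not> P_position (G + s H')"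
    by metis
  have "\<exists>S. P_position (G' + S) \<and> \<not> P_position (H + S)" if "G' |\<in>| opts G" for G'
    using distinguish[OF G[OF that, symmetric]] by blast
  then obtain t where t: "\<And>G'. G' |\<in>| opts G \<Longrightarrow> P_position (G' + t G') \<and> \<not> P_position (H + t G')"
    by metis
  define T where "T = Game ((s |`| opts H) |\<union>| (t |`| opts G))"
  have oT: "opts T = (s |`| opts H) |\<union>| (t |`| opts G)" by (simp add: T_def)
  have T0: "T \<noteq> 0" using False opts_empty_iff oT
    by (metis fempty_is_fimage funion_fempty_right sup_eq_bot_iff)
  have "P_position (G + T)"
  proof (rule P_I)
    show "G + T \<noteq> 0" using T0 by (simp add: plus_eq_0)
    fix Y assume "Y |\<in>| opts (G + T)"
    then consider G' where "G' |\<in>| opts G" "Y = G' + T" | H' where "H' |\<in>| opts H" "Y = G + s H'"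
      | G' where "G' |\<in>| opts G" "Y = G + t G'"
      unfolding mem_opts_plus oT by auto
    then show "\<not> P_position Y"
    proof cases
      case 1
      then have "G' + t G' |\<in>| opts Y" by (auto intro!: opt2 simp: oT)
      then show ?thesis using t 1 N_I by blast
    next
      case 2
      then show ?thesis using s by simp
    next
      case 3
      then have "G' + t G' |\<in>| opts Y" by (auto intro!: opt1)
      then show ?thesis using t 3 N_I by blast
    qed
  qed
  moreover have "P_position (H + T)"
  proof (rule P_I)
    show "H + T \<noteq> 0" using T0 by (simp add: plus_eq_0)
    fix Y assume "Y |\<in>| opts (H + T)"
    then consider H' where "H' |\<in>| opts H" "Y = H' + T" | H' where "H' |\<in>| opts H" "Y = H + s H'"
      | G' where "G' |\<in>| opts G" "Y = H + t G'"
      unfolding mem_opts_plus oT by auto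
    then show "\<not> P_position Y"
    proof cases
      case 1
      then have "H' + s H' |\<in>| opts Y" by (auto intro!: opt2 simp: oT)
      then show ?thesis using s 1 N_I by blast
    next
      case 2
      then have "H' + s H' |\<in>| opts Y" by (auto intro!: opt1)
      then show ?thesis using s 2 N_I by blast
    next
      case 3
      then show ?thesis using t by simp
    qed
  qed
  ultimately show ?thesis unfolding linked_def by blast
qed

lemma option_not_linked:
  assumes "G' |\<in>| opts G" "abs_mgame G = abs_mgame H"
  shows "\<not> linked G' H"
  using assms unfolding linked_def mgame_eq_iff by (metis N_I opt1)

lemma linked_refl: "linked G G" using mate_exists unfolding linked_def by blast

lemma option_neq: "G' |\<in>| opts G \<Longrightarrow> abs_mgame G' \<noteq> abs_mgame G"
  using option_not_linked linked_eq linked_refl by blast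

lemma mgame_eqI:
  assumes "\<And>G'. G' |\<in>| opts G \<Longrightarrow> \<not> linked G' H" "\<And>H'. H' |\<in>| opts H \<Longrightarrow> \<not> linked H' G"
    and "H = 0 \<Longrightarrow> \<not> P_position G" "G = 0 \<Longrightarrow> \<not> P_position H"
  shows "abs_mgame G = abs_mgame H"
proof -
  have "P_position (G + X) = P_position (H + X)" for X
  proof (induction "size X" arbitrary: X rule: less_induct)
    case less
    have IH: "P_position (G + X') = P_position (H + X')" if "X' |\<in>| opts X" for X'
      using less size_opts[OF that] by simp
    have aux: "P_position (L + X)" if K: "P_position (K + X)"
      and IH: "\<And>X'. X' |\<in>| opts X \<Longrightarrow> P_position (K + X') = P_position (L + X')"
      and nl: "\<And>L'. L' |\<in>| opts L \<Longrightarrow> \<not> linked L' K" and pr: "L = 0 \<Longrightarrow> \<not> P_position K"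
      for K L
    proof (rule P_I)
      show "L + X \<noteq> 0" using K pr by (auto simp: plus_eq_0)
      fix Y assume "Y |\<in>| opts (L + X)"
      then consider L' where "L' |\<in>| opts L" "Y = L' + X" | X' where "X' |\<in>| opts X" "Y = L + X'"
        unfolding mem_opts_plus by blast
      then show "\<not> P_position Y"
      proof cases
        case 1
        then show ?thesis using nl K unfolding linked_def by blast
      next
        case 2
        then show ?thesis using IH P_option[OF K opt2] by blast
      qed
    qed
    show ?case
      using aux[of G H] aux[of H G] IH assms by metis
  qed
  then show ?thesis by (simp add: mgame_eq_iff)
qed

lemma linked_add:
  assumes "linked A B"
    and "\<And>R A'. R = S \<or> size R < size S \<Longrightarrow> A' |\<in>| opts A \<Longrightarrow>
      abs_mgame (A' + R) = abs_mgame (B + R) \<Longrightarrow> abs_mgame A' = abs_mgame B"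
    and "\<And>R B'. R = S \<or> size R < size S \<Longrightarrow> B' |\<in>| opts B \<Longrightarrow>
      abs_mgame (A + R) = abs_mgame (B' + R) \<Longrightarrow> abs_mgame A = abs_mgame B'"
  shows "linked (A + S) (B + S)"
  using assms
proof (induction "size S" arbitrary: S rule: less_induct)
  case less
  note hA = less.prems(2) and hB = less.prems(3)
  have IH: "linked (A + S') (B + S')" if "S' |\<in>| opts S" for S'
    using size_opts[OF that] less.prems(1)
    by (intro less.hyps) (auto intro: hA hB dest: less_trans)
  show ?case
  proof (rule linkedI)
    fix H' assume "H' |\<in>| opts (B + S)"
    then consider B' where "B' |\<in>| opts B" "H' = B' + S" | S' where "S' |\<in>| opts S" "H' = B + S'"
      unfolding mem_opts_plus by blast
    then show "abs_mgame (A + S) \<noteq> abs_mgame H'"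
    proof cases
      case 1
      show ?thesis
      proof
        assume "abs_mgame (A + S) = abs_mgame H'"
        then have "abs_mgame A = abs_mgame B'" using hB 1 by blast
        then show False using 1 less.prems(1) option_not_linked linked_sym linked_eq by metis
      qed
    next
      case 2
      then show ?thesis using IH option_not_linked opt2 by blast
    qed
  next
    fix G' assume "G' |\<in>| opts (A + S)"
    then consider A' where "A' |\<in>| opts A" "G' = A' + S" | S' where "S' |\<in>| opts S" "G' = A + S'"
      unfolding mem_opts_plus by blast
    then show "abs_mgame G' \<noteq> abs_mgame (B + S)"
    proof cases
      case 1
      show ?thesis
      proof
        assume "abs_mgame G' = abs_mgame (B + S)"
        then have "abs_mgame A' = abs_mgame B" using hA 1 by blast
        then show False using 1 less.prems(1) option_not_linked linked_sym linked_eq by metis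
      qed
    next
      case 2
      then show ?thesis using IH option_not_linked opt2 linked_sym by metis
    qed
  qed
qed

lemma mgame_zero: "abs_mgame 0 = 0" and mgame_one: "abs_mgame 1 = 1"
  by (simp_all add: zero_mgame_def one_mgame_def)

lemma mgame_one_neq_zero: "(1 :: mgame) \<noteq> 0"
  using mgame_outcome[of 1 0] by (auto simp: mgame_zero mgame_one)

lemma mgame_one_plus_one: "(1 :: mgame) + 1 = 0"
proof -
  have o11: "opts (1 + 1) = {|1|}" by (simp add: opts_plus)
  have "abs_mgame (1 + 1) = abs_mgame 0"
  proof (rule mgame_eqI)
    fix G' :: game assume "G' |\<in>| opts (1 + 1)"
    then show "\<not> linked G' 0" using o11 option_not_linked[of 0 1 1] linked_sym by auto
  next
    show "\<not> P_position (1 + 1)" by (rule N_I[of 1]) (simp_all add: o11)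
  qed simp_all
  then show ?thesis by (simp add: mgame_add mgame_zero mgame_one)
qed

lemma linked_eq': "linked G H \<Longrightarrow> abs_mgame G = abs_mgame G' \<Longrightarrow> abs_mgame H = abs_mgame H' \<Longrightarrow> linked G' H'"
  using linked_eq linked_sym by blast

lemma zero_summand_step:
  assumes XY: "abs_mgame (X + Y) = 0"
    and IH: "\<And>X' Y'. size X' + size Y' < size X + size Y \<Longrightarrow> abs_mgame (X' + Y') = 0 \<Longrightarrow>
      abs_mgame X' \<in> {0, 1}"
    and n: "abs_mgame X \<notin> {0, 1}" and X': "X' |\<in>| opts X"
  shows "\<exists>Y'. Y' |\<in>| opts Y \<and> abs_mgame X' \<in> {0, 1} \<and> abs_mgame Y' = abs_mgame X'"
proof -
  have "\<not> linked (X' + Y) 0"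
    using option_not_linked[OF opt1[OF X', of Y], of 0] XY by (simp add: mgame_zero)
  then obtain Z where Z: "Z |\<in>| opts (X' + Y)" "abs_mgame Z = 0"
    using linkedI[of 0 "X' + Y"] by (auto simp: mgame_zero)
  from Z(1) consider X'' where "X'' |\<in>| opts X'" "Z = X'' + Y" | Y' where "Y' |\<in>| opts Y" "Z = X' + Y'"
    unfolding mem_opts_plus by blast
  then show ?thesis
  proof cases
    case 1
    then have "abs_mgame X'' + abs_mgame Y = 0" "abs_mgame X + abs_mgame Y = 0"
      using Z(2) XY by (simp_all add: mgame_add)
    then have "abs_mgame X'' = abs_mgame X"
      by (metis add.assoc add.commute add.right_neutral)
    moreover have "abs_mgame X'' \<in> {0, 1}"
      using 1 Z(2) size_opts[OF X'] size_opts[of X'' X'] by (intro IH) auto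
    ultimately show ?thesis using n by simp
  next
    case 2
    then have s: "abs_mgame X' + abs_mgame Y' = 0" using Z(2) by (simp add: mgame_add)
    have "abs_mgame X' \<in> {0, 1}"
      using 2 Z(2) size_opts[OF X'] size_opts[of Y' Y] by (intro IH) auto
    moreover from this have "abs_mgame Y' = abs_mgame X'"
      using s mgame_one_plus_one by (metis add.assoc add.left_neutral add.right_neutral insertE singletonD)
    ultimately show ?thesis using 2 by blast
  qed
qed

lemma zero_summand:
  assumes "abs_mgame (X + Y) = 0"
  shows "abs_mgame X \<in> {0, 1}"
  using assms
proof (induction "size X + size Y" arbitrary: X Y rule: less_induct)
  case less
  note XY = less.prems
  have IH: "abs_mgame X' \<in> {0, 1}"
    if "size X' + size Y' < size X + size Y" "abs_mgame (X' + Y') = 0" for X' Y'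
    using less.hyps that by blast
  show ?case
  proof (rule ccontr)
    assume nX: "abs_mgame X \<notin> {0, 1}"
    have nY: "abs_mgame Y \<notin> {0, 1}"
      using nX XY mgame_one_plus_one unfolding mgame_add
      by (metis add.assoc add.left_neutral add.right_neutral insertE insertI1 insert_commute singletonD)
    have sX: "\<exists>Y'. Y' |\<in>| opts Y \<and> abs_mgame X' \<in> {0, 1} \<and> abs_mgame Y' = abs_mgame X'"
      if "X' |\<in>| opts X" for X'
      by (rule zero_summand_step[OF XY IH nX that]) auto
    have sY: "\<exists>X'. X' |\<in>| opts X \<and> abs_mgame Y' \<in> {0, 1} \<and> abs_mgame X' = abs_mgame Y'"
      if "Y' |\<in>| opts Y" for Y'
    proof (rule zero_summand_step[OF _ _ nY that])
      show "abs_mgame (Y + X) = 0" using XY by (simp add: add.commute)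
    qed (use IH in \<open>auto simp: add.commute\<close>)
    have o0: "\<not> P_position Z" if "abs_mgame Z = 0" for Z
      using mgame_outcome[of Z 0] that by (simp add: mgame_zero)
    have o1: "P_position Z" if "abs_mgame Z = 1" for Z
      using mgame_outcome[of Z 1] that by (simp add: mgame_one)
    have l10: "\<not> linked 1 0"
      using option_not_linked[of 1 "1 + 1" 0] mgame_one_plus_one
      by (simp add: mgame_add mgame_one mgame_zero opts_plus)
    have x1: "\<exists>X0. X0 |\<in>| opts X \<and> abs_mgame X0 = 0"
    proof (rule ccontr)
      assume "\<not> ?thesis"
      then have all: "abs_mgame X' = 1" if "X' |\<in>| opts X" for X' using sX that by blast
      have "abs_mgame X = abs_mgame 0"
      proof (rule mgame_eqI)
        fix G' assume "G' |\<in>| opts X"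
        then show "\<not> linked G' 0" using l10 all linked_eq'[of G' 0 1 0] by (auto simp: mgame_one)
      next
        show "\<not> P_position X" using all o1 P_position.simps[of X] by fast
      qed simp_all
      then show False using nX by (simp add: mgame_zero)
    qed
    have x2: "\<exists>X1. X1 |\<in>| opts X \<and> abs_mgame X1 = 1"
    proof (rule ccontr)
      assume "\<not> ?thesis"
      then have all: "abs_mgame X' = 0" if "X' |\<in>| opts X" for X' using sX that by blast
      have "abs_mgame X = abs_mgame 1"
      proof (rule mgame_eqI)
        fix G' assume "G' |\<in>| opts X"
        then show "\<not> linked G' 1" 
          using l10 all linked_eq'[of G' 1 0 1] linked_sym by (auto simp: mgame_zero)
      next
        fix H' :: game assume "H' |\<in>| opts 1"
        then show "\<not> linked H' X"
          using x1 option_not_linked[of _ X X] linked_eq'[of 0 X] by (auto simp: mgame_zero)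
      qed (use x1 in auto)
      then show False using nX by (simp add: mgame_one)
    qed
    obtain Y0 Y1 where Y: "Y0 |\<in>| opts Y" "abs_mgame Y0 = 0" "Y1 |\<in>| opts Y" "abs_mgame Y1 = 1"
      using x1 x2 sX by metis
    obtain X0 X1 where X: "X0 |\<in>| opts X" "abs_mgame X0 = 0" "X1 |\<in>| opts X" "abs_mgame X1 = 1"
      using x1 x2 by metis
    have aux: "\<not> P_position (A + B)" if "abs_mgame A \<in> {0,1}" "B0 |\<in>| opts B" "abs_mgame B0 = 0"
      "B1 |\<in>| opts B" "abs_mgame B1 = 1" for A B B0 B1
    proof (cases "abs_mgame A = 0")
      case True
      then show ?thesis using that by (intro N_I[of "A + B1"] opt2 o1) (auto simp: mgame_add)
    next
      case False
      then show ?thesis using that by (intro N_I[of "A + B0"] opt2 o1) (auto simp: mgame_add)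
    qed
    have "P_position (X + Y)"
    proof (rule P_I)
      show "X + Y \<noteq> 0" using X by (auto simp: plus_eq_0)
      fix Z assume "Z |\<in>| opts (X + Y)"
      then consider X' where "X' |\<in>| opts X" "Z = X' + Y" | Y' where "Y' |\<in>| opts Y" "Z = X + Y'"
        unfolding mem_opts_plus by blast
      then show "\<not> P_position Z"
      proof cases
        case 1
        then show ?thesis using aux[of X' Y0 Y Y1] sX Y by blast
      next
        case 2
        then show ?thesis using aux[of Y' X0 X X1] sY X by (metis add.commute)
      qed
    qed
    then show False using o0 XY by blast
  qed
qed

definition cancellable :: "game \<Rightarrow> bool" where
  "cancellable T \<longleftrightarrow> (\<forall>G H. abs_mgame (G + T) = abs_mgame (H + T) \<longrightarrow> abs_mgame G = abs_mgame H)"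

lemma cancellable_part:
  assumes "cancellable C" "abs_mgame (X + T) = abs_mgame C"
  shows "cancellable T"
  unfolding cancellable_def
proof (intro allI impI)
  fix G H assume eq: "abs_mgame (G + T) = abs_mgame (H + T)"
  have *: "abs_mgame (K + C) = abs_mgame X + abs_mgame (K + T)" for K
    unfolding mgame_add[of K C] assms(2)[symmetric] by (simp add: mgame_add ac_simps)
  have "abs_mgame (G + C) = abs_mgame (H + C)"
    unfolding * eq ..
  then show "abs_mgame G = abs_mgame H" using assms(1) unfolding cancellable_def by blast
qed

lemma no_absorb:
  assumes GT: "abs_mgame (G + T) = abs_mgame T" and P: "P_position G"
    and IH: "\<And>R. size R < size T \<Longrightarrow> cancellable R"
  shows False
proof -
  have G0: "abs_mgame G \<noteq> abs_mgame 0" using P mgame_outcome[of G 0] by auto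
  have nT: "\<not> cancellable T" using G0 GT unfolding cancellable_def by (metis add.left_neutral)
  have step: "\<exists>T1. T1 |\<in>| opts T \<and> abs_mgame T' = abs_mgame (G + T1)" if T': "T' |\<in>| opts T" for T'
  proof -
    have "\<not> linked T' (G + T)" using option_not_linked[OF T'] GT by simp
    then consider H' where "H' |\<in>| opts (G + T)" "abs_mgame T' = abs_mgame H'"
      | T'' where "T'' |\<in>| opts T'" "abs_mgame T'' = abs_mgame (G + T)"
      using linkedI[of "G + T" T'] by blast
    then show ?thesis
    proof cases
      case 1
      then consider G' where "G' |\<in>| opts G" "H' = G' + T" | T1 where "T1 |\<in>| opts T" "H' = G + T1"
        unfolding mem_opts_plus by blast
      then show ?thesis
      proof cases
        case 1
        then have "cancellable T"
          using cancellable_part[OF IH[OF size_opts[OF T']], of G' T] \<open>abs_mgame T' = abs_mgame H'\<close> by simp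
        then show ?thesis using nT by simp
      next
        case 2
        then show ?thesis using \<open>abs_mgame T' = abs_mgame H'\<close> by blast
      qed
    next
      case 2
      then have "size T'' < size T" using size_opts[OF T'] size_opts[of T'' T'] by simp
      then have "cancellable T" using cancellable_part[OF IH, of T'' G T] 2 by simp
      then show ?thesis using nT by simp
    qed
  qed
  then obtain f where f: "\<And>T'. T' |\<in>| opts T \<Longrightarrow> f T' |\<in>| opts T \<and> abs_mgame T' = abs_mgame (G + f T')"
    by metis
  have "T \<noteq> 0" using GT G0 by auto
  then obtain t where t: "t |\<in>| opts T" using opts_empty_iff[of T] by auto
  define s where "s n = (f ^^ n) t" for n
  have s: "s n |\<in>| opts T" for n unfolding s_def by (induction n) (simp_all add: t f)
  have ss: "abs_mgame (s n) = abs_mgame G + abs_mgame (s (Suc n))" for n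
    using f[OF s[of n]] by (simp add: s_def mgame_add)
  have sk: "abs_mgame (s n) = (\<Sum>i<k. abs_mgame G) + abs_mgame (s (n + k))" for n k
  proof (induction k)
    case (Suc k)
    then show ?case using ss[of "n + k"] by (simp add: ac_simps)
  qed simp
  have "\<not> inj s"
  proof
    assume "inj s"
    moreover have "finite (range s)" by (rule finite_subset[of _ "fset (opts T)"]) (use s in auto)
    ultimately show False using finite_imageD infinite_UNIV_nat by blast
  qed
  then obtain i j where ij: "s i = s j" "i < j" unfolding inj_def by (metis linorder_neqE_nat)
  then obtain k where k: "j = i + Suc k" using less_imp_Suc_add by auto
  have "\<exists>H. abs_mgame H = (\<Sum>i<k. abs_mgame G)"
    by (metis Quotient3_abs_rep Quotient3_mgame)
  then obtain H where H: "abs_mgame H = (\<Sum>i<k. abs_mgame G)" by blast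
  have "abs_mgame ((G + H) + s i) = abs_mgame (0 + s i)"
    using sk[of i "Suc k"] ij k H by (simp add: mgame_add ac_simps)
  moreover have "cancellable (s i)" using IH size_opts s by blast
  ultimately have "abs_mgame (G + H) = 0" unfolding cancellable_def mgame_zero[symmetric] by blast
  from zero_summand[OF this] have "abs_mgame G = 1" using G0 by (simp add: mgame_zero)
  then have "abs_mgame (1 + T) = abs_mgame T" using GT by (simp add: mgame_add mgame_one)
  moreover have "T |\<in>| opts (1 + T)" using opt1[of 0 1 T] by simp
  ultimately show False using option_neq by metis
qed

lemma all_cancellable: "cancellable T"
proof (induction "size T" arbitrary: T rule: less_induct)
  case less
  note IHT = less.hyps
  have "abs_mgame G = abs_mgame H" if "abs_mgame (G + T) = abs_mgame (H + T)" for G H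
    using that
  proof (induction "size G + size H" arbitrary: G H rule: less_induct)
    case less
    note IH = less.hyps and eq = less.prems
    have main: "\<not> linked A' B"
      if e: "abs_mgame (A + T) = abs_mgame (B + T)" and A': "A' |\<in>| opts A"
        and sz: "size A + size B = size G + size H" for A B A'
    proof
      assume l: "linked A' B"
      have "linked (A' + T) (B + T)"
      proof (rule linked_add[OF l])
        fix R A'' assume *: "R = T \<or> size R < size T" "A'' |\<in>| opts A'"
          "abs_mgame (A'' + R) = abs_mgame (B + R)"
        show "abs_mgame A'' = abs_mgame B"
        proof (cases "R = T")
          case True
          have "size A'' + size B < size G + size H"
            using size_opts[OF A'] size_opts[OF *(2)] sz by linarith
          then show ?thesis using IH *(3) True by blast
        next
          case False
          then show ?thesis using * IHT[of R] unfolding cancellable_def by blast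
        qed
      next
        fix R B' assume *: "R = T \<or> size R < size T" "B' |\<in>| opts B"
          "abs_mgame (A' + R) = abs_mgame (B' + R)"
        show "abs_mgame A' = abs_mgame B'"
        proof (cases "R = T")
          case True
          have "size A' + size B' < size G + size H"
            using size_opts[OF A'] size_opts[OF *(2)] sz by linarith
          then show ?thesis using IH *(3) True by blast
        next
          case False
          then show ?thesis using * IHT[of R] unfolding cancellable_def by blast
        qed
      qed
      then show False using option_not_linked[OF opt1[OF A'] e] by blast
    qed
    show ?case
    proof (rule mgame_eqI)
      show "\<not> linked G' H" if "G' |\<in>| opts G" for G' using main eq that by blast
      show "\<not> linked H' G" if "H' |\<in>| opts H" for H' using main[of H G] eq that by simp
      show "\<not> P_position G" if "H = 0" using no_absorb[of G T] eq that IHT by auto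
      show "\<not> P_position H" if "G = 0" using no_absorb[of H T] eq that IHT by auto
    qed
  qed
  then show ?case unfolding cancellable_def by blast
qed

instance mgame :: cancel_semigroup_add
proof
  fix a b c :: mgame
  have right: "b = c" if eq: "b + a = c + a" for a b c :: mgame
  proof -
    obtain A B C where "a = abs_mgame A" "b = abs_mgame B" "c = abs_mgame C"
      by (metis Quotient3_abs_rep Quotient3_mgame)
    then show ?thesis
      using eq all_cancellable[of A] unfolding cancellable_def mgame_add by blast
  qed
  show "b = c" if "b + a = c + a" using right that .
  show "b = c" if "a + b = a + c" using right[of b a c] that by (simp only: add.commute)
qed

section \<open>The group of differences\<close>

definition diff_eq :: "mgame \<times> mgame \<Rightarrow> mgame \<times> mgame \<Rightarrow> bool" where
  "diff_eq = (\<lambda>(G1, H1) (G2, H2). G1 + H2 = G2 + H1)"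

quotient_type dgame = "mgame \<times> mgame" / diff_eq
proof (rule equivpI)
  show "reflp diff_eq" by (auto simp: reflp_def diff_eq_def)
  show "symp diff_eq" by (auto simp: symp_def diff_eq_def)
  show "transp diff_eq"
  proof (rule transpI, clarsimp simp: diff_eq_def)
    fix a b c d e f :: mgame
    assume 1: "a + d = c + b" and 2: "c + f = e + d"
    have "d + (a + f) = (a + d) + f" by (simp add: ac_simps)
    also have "\<dots> = (c + f) + b" by (simp add: 1 ac_simps)
    also have "\<dots> = d + (e + b)" by (simp add: 2 ac_simps)
    finally show "a + f = e + b" by simp
  qed
qed

instantiation dgame :: ab_group_add
begin

lift_definition zero_dgame :: dgame is "(0, 0)" .

lift_definition plus_dgame :: "dgame \<Rightarrow> dgame \<Rightarrow> dgame" is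
  "\<lambda>(G1, H1) (G2, H2). (G1 + G2, H1 + H2)"
  by (clarsimp simp: diff_eq_def) (metis add.assoc add.commute)

lift_definition uminus_dgame :: "dgame \<Rightarrow> dgame" is "\<lambda>(G, H). (H, G)"
  by (auto simp: diff_eq_def add.commute)

definition minus_dgame :: "dgame \<Rightarrow> dgame \<Rightarrow> dgame" where
  "x - y = x + - (y :: dgame)"

instance
  by standard (auto simp: minus_dgame_def, (transfer; auto simp: diff_eq_def ac_simps)+)

end

definition of_mgame :: "mgame \<Rightarrow> dgame" where
  "of_mgame G = abs_dgame (G, 0)"

lemma of_mgame_inject [simp]: "of_mgame G = of_mgame H \<longleftrightarrow> G = H"
  by (simp add: of_mgame_def dgame.abs_eq_iff diff_eq_def)

lemma of_mgame_zero [simp]: "of_mgame 0 = 0"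
  by (simp add: of_mgame_def zero_dgame_def)

lemma of_mgame_add [simp]: "of_mgame (G + H) = of_mgame G + of_mgame H"
  by (simp add: of_mgame_def plus_dgame.abs_eq)

lemma dgame_diff_abs: "of_mgame G - of_mgame H = abs_dgame (G, H)"
  by (simp add: of_mgame_def minus_dgame_def uminus_dgame.abs_eq plus_dgame.abs_eq)

lemma dgame_is_difference: "\<exists>G H. x = of_mgame G - of_mgame H"
  by (induct x rule: dgame.abs_induct) (auto simp: dgame_diff_abs)

lemma dgame_difference_eq_iff:
  "of_mgame G1 - of_mgame H1 = of_mgame G2 - of_mgame H2 \<longleftrightarrow> G1 + H2 = G2 + H1"
  by (simp add: dgame_diff_abs dgame.abs_eq_iff diff_eq_def)

text \<open>The sum of \<open>n\<close> copies of \<open>x\<close> is the multiple \<open>n \<cdot> x\<close>; with this definition \<open>0\<close> is torsion.\<close>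

definition torsion :: "'a :: ab_group_add \<Rightarrow> bool" where
  "torsion x \<longleftrightarrow> (\<exists>n::nat. n > 0 \<and> (\<Sum>i<n. x) = 0)"

end

theory Submission
  imports Defs
begin

text \<open>Writing an element of the group as \<open>G - H\<close>, the claim is that \<open>n\<cdot>G = n\<cdot>H\<close> with \<open>n > 0\<close>
  forces \<open>G = H\<close> or \<open>G = H + 1\<close>. Let \<open>K\<close> be a smallest game equal to \<open>n\<cdot>G\<close>, hence also to \<open>n\<cdot>H\<close>.
  Minimality rules out reversible options, so every option of \<open>K\<close> must equal an option of any game
  that \<open>K\<close> equals (\<open>irreducible_representative\<close>). If \<open>K\<close> has an option, that option equals both
  \<open>G' + (n-1)\<cdot>G\<close> and \<open>H' + (n-1)\<cdot>H\<close> for suitable options \<open>G'\<close> and \<open>H'\<close>; subtracting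
  \<open>n\<cdot>G = n\<cdot>H\<close> gives \<open>G' - H' = G - H\<close>. The same torsion element is thus a difference of simpler
  games, and induction applies. The descent stops only when \<open>K\<close> is empty. Then \<open>n\<cdot>G = n\<cdot>H = 0\<close>,
  and a summand of \<open>0\<close> can only be \<open>0\<close> or \<open>1\<close>.\<close>

text \<open>If \<open>K'\<close> is an option of \<open>K\<close> and \<open>K = L\<close>, no game makes both \<open>K'\<close> and \<open>L\<close> P-positions. So
  either \<open>K'\<close> equals an option of \<open>L\<close>, or \<open>K'\<close> reverts to an option equal to \<open>K\<close>; a smallest
  representative \<open>K\<close> excludes the latter.\<close>

lemma irreducible_representative:
  obtains K where "abs_mgame K = g"
    and "\<And>K' L. K' |\<in>| opts K \<Longrightarrow> abs_mgame L = g \<Longrightarrow> \<exists>L'. L' |\<in>| opts L \<and> abs_mgame K' = abs_mgame L'"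
proof -
  obtain K0 where "abs_mgame K0 = g"
    by (metis Quotient3_abs_rep Quotient3_mgame)
  then obtain K where K: "abs_mgame K = g"
    and min: "\<And>L. abs_mgame L = g \<Longrightarrow> size K \<le> size L"
    using ex_has_least_nat[of "\<lambda>L. abs_mgame L = g" K0 size] by blast
  have "\<exists>L'. L' |\<in>| opts L \<and> abs_mgame K' = abs_mgame L'"
    if K': "K' |\<in>| opts K" and L: "abs_mgame L = g" for K' L
  proof (rule ccontr)
    assume no: "\<not> ?thesis"
    have "\<not> linked K' L"
      using option_not_linked[OF K'] K L by simp
    then obtain K'' where K'': "K'' |\<in>| opts K'" "abs_mgame K'' = abs_mgame L"
      using linkedI[of L K'] no by blast
    then have "size K'' < size K"
      using size_opts[OF K'] size_opts[OF K''(1)] by simp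
    then show False
      using min[of K''] K'' L by simp
  qed
  with K show thesis by (rule that)
qed

lemma opts_multiple:
  fixes n :: nat
  assumes "X |\<in>| opts (\<Sum>i<Suc n. G)"
  shows "\<exists>G'. G' |\<in>| opts G \<and> X = G' + (\<Sum>i<n. G)"
  using assms
proof (induction n arbitrary: X)
  case 0
  then show ?case by simp
next
  case (Suc n)
  then have "X |\<in>| opts ((\<Sum>i<Suc n. G) + G)" by simp
  then consider Y where "Y |\<in>| opts (\<Sum>i<Suc n. G)" "X = Y + G"
    | G' where "G' |\<in>| opts G" "X = (\<Sum>i<Suc n. G) + G'"
    unfolding mem_opts_plus by blast
  then show ?case
  proof cases
    case 1
    then show ?thesis using Suc.IH by (fastforce simp: add.assoc)
  next
    case 2
    then show ?thesis by (auto simp: add.commute)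
  qed
qed

lemma abs_mgame_multiple: "abs_mgame (\<Sum>i<n. G) = (\<Sum>i<n. abs_mgame G)" for n :: nat
  by (induction n) (simp_all add: mgame_add mgame_zero)

lemma of_mgame_multiple: "of_mgame (\<Sum>i<n. g) = (\<Sum>i<n. of_mgame g)" for n :: nat
  by (induction n) simp_all

lemma multiple_eq_zero:
  fixes m :: nat
  assumes "(\<Sum>i<Suc m. abs_mgame G) = 0"
  shows "abs_mgame G \<in> {0, 1}"
proof (rule zero_summand)
  show "abs_mgame (G + (\<Sum>i<m. G)) = 0"
    using assms by (simp add: mgame_add abs_mgame_multiple add.commute)
qed

text \<open>One irreducible representative \<open>K\<close> serves both multiples, so a single option of \<open>K\<close> picks out
  an option of \<open>G\<close> and an option of \<open>H\<close> with the same difference as \<open>G\<close> and \<open>H\<close>; that difference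
  is again annihilated by \<open>n\<close>, which keeps the hypothesis alive in the induction.\<close>

lemma multiple_eq_imp:
  fixes n :: nat
  assumes "n > 0" and "(\<Sum>i<n. abs_mgame G) = (\<Sum>i<n. abs_mgame H)"
  shows "abs_mgame G = abs_mgame H \<or> abs_mgame G = abs_mgame H + 1"
  using assms(2)
proof (induction "size G + size H" arbitrary: G H rule: less_induct)
  case less
  obtain m where n: "n = Suc m" using assms(1) by (cases n) auto
  define mG mH where "mG = (\<Sum>i<m. abs_mgame G)" and "mH = (\<Sum>i<m. abs_mgame H)"
  have eq: "mG + abs_mgame G = mH + abs_mgame H"
    using less.prems by (simp add: n mG_def mH_def)
  obtain K where K: "abs_mgame K = (\<Sum>i<n. abs_mgame G)"
    and opt: "\<And>K' L. K' |\<in>| opts K \<Longrightarrow> abs_mgame L = (\<Sum>i<n. abs_mgame G) \<Longrightarrow>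
      \<exists>L'. L' |\<in>| opts L \<and> abs_mgame K' = abs_mgame L'"
    by (rule irreducible_representative) blast
  show ?case
  proof (cases "K = 0")
    case True
    then have "(\<Sum>i<n. abs_mgame G) = 0" using K by (simp add: mgame_zero)
    then have "abs_mgame G \<in> {0, 1}" "abs_mgame H \<in> {0, 1}"
      using multiple_eq_zero less.prems n by metis+
    \<comment> \<open>For \<open>G = 0\<close> and \<open>H = 1\<close> the second alternative holds because \<open>0 = 1 + 1\<close>.\<close>
    then show ?thesis using mgame_one_plus_one by auto
  next
    case False
    then obtain K' where K': "K' |\<in>| opts K" using opts_empty_iff[of K] by auto
    obtain G' where G': "G' |\<in>| opts G" "abs_mgame K' = abs_mgame G' + mG"
      using opt[OF K', of "\<Sum>i<n. G"] opts_multiple[where n = m and G = G]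
      unfolding n mG_def by (metis abs_mgame_multiple mgame_add)
    obtain H' where H': "H' |\<in>| opts H" "abs_mgame K' = abs_mgame H' + mH"
      using opt[OF K', of "\<Sum>i<n. H"] opts_multiple[where n = m and G = H] less.prems
      unfolding n mH_def by (metis abs_mgame_multiple mgame_add)
    have "(abs_mgame G' + abs_mgame H) + (mG + mH) = (abs_mgame G' + mG) + (mH + abs_mgame H)"
      by (simp add: ac_simps)
    also have "\<dots> = (abs_mgame H' + mH) + (mG + abs_mgame G)"
      using G'(2) H'(2) eq by simp
    also have "\<dots> = (abs_mgame H' + abs_mgame G) + (mG + mH)"
      by (simp add: ac_simps)
    finally have diff: "abs_mgame G' + abs_mgame H = abs_mgame H' + abs_mgame G"
      by simp
    then have "(\<Sum>i<n. abs_mgame G') + (\<Sum>i<n. abs_mgame H) =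
        (\<Sum>i<n. abs_mgame H') + (\<Sum>i<n. abs_mgame G)"
      by (simp flip: sum.distrib)
    then have "(\<Sum>i<n. abs_mgame G') = (\<Sum>i<n. abs_mgame H')"
      using less.prems by simp
    then consider "abs_mgame G' = abs_mgame H'" | "abs_mgame G' = abs_mgame H' + 1"
      using less.hyps[of G' H'] size_opts[OF G'(1)] size_opts[OF H'(1)] by auto
    then show ?thesis
    proof cases
      case 1
      then show ?thesis using diff by simp
    next
      case 2
      then have "abs_mgame H' + (abs_mgame H + 1) = abs_mgame H' + abs_mgame G"
        using diff by (simp add: ac_simps)
      then show ?thesis by simp
    qed
  qed
qed

theorem corollary6p9:
  shows "{x :: dgame. torsion x \<and> x \<noteq> 0} = {of_mgame 1}"
proof (rule equalityI; rule subsetI)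
  fix x :: dgame
  assume "x \<in> {x. torsion x \<and> x \<noteq> 0}"
  then obtain n :: nat where n: "n > 0" "(\<Sum>i<n. x) = 0" and x0: "x \<noteq> 0"
    by (auto simp: torsion_def)
  obtain g h where x: "x = of_mgame g - of_mgame h"
    using dgame_is_difference by blast
  obtain G H where GH: "abs_mgame G = g" "abs_mgame H = h"
    by (metis Quotient3_abs_rep Quotient3_mgame)
  have "(\<Sum>i<n. of_mgame g) = (\<Sum>i<n. of_mgame h)"
    using n(2) by (simp add: x sum_subtractf)
  then have "(\<Sum>i<n. g) = (\<Sum>i<n. h)"
    by (simp flip: of_mgame_multiple)
  then have "g = h \<or> g = h + 1"
    using multiple_eq_imp[OF n(1), of G H] GH by simp
  then show "x \<in> {of_mgame 1}" using x x0 by auto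
next
  fix x :: dgame
  assume x: "x \<in> {of_mgame 1}"
  have "of_mgame 1 + of_mgame 1 = 0"
    using mgame_one_plus_one by (simp flip: of_mgame_add)
  then have "(\<Sum>i<2::nat. x) = 0"
    using x by (simp add: numeral_2_eq_2)
  then have "torsion x" unfolding torsion_def by (intro exI[of _ 2]) simp
  moreover have "x \<noteq> 0"
    using x mgame_one_neq_zero of_mgame_inject[of 1 0] by simp
  ultimately show "x \<in> {x. torsion x \<and> x \<noteq> 0}" by simp
qed

end
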